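(* Let $K$ be a triangle with vertices $\bm v^{(1)},\bm v^{(2)},\bm v^{(3)}$, let $e_K^{(i)}$ be the edge opposite $\bm v^{(i)}$, with length $l_K^{(i)}$, indexed so that $l_K^{(1)}\ge l_K^{(2)}\ge l_K^{(3)}$. Consider the convex decomposition with edge weights $$w_i=\frac{2l_K^{(i)}}{3l_K^{(1)}+3l_K^{(2)}},\qquad i=1,2,3,$$ and a single internal node with weight and position $$\omega_1=\frac{l_K^{(1)}+l_K^{(2)}-2l_K^{(3)}}{3l_K^{(1)}+3l_K^{(2)}},\qquad(\xi_1,\eta_1)^\top=\frac{(l_K^{(1)}-l_K^{(3)})\bm v^{(1)}+(l_K^{(2)}-l_K^{(3)})\bm v^{(2)}}{l_K^{(1)}+l_K^{(2)}-2l_K^{(3)}}$$ (if $l_K^{(1)}=l_K^{(2)}=l_K^{(3)}$, then $\omega_1=0$ and there is no internal node). This convex decomposition is feasible and optimal for the space $\mathbb P^1$ on $K$.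
   Context: A convex decomposition of the cell average on a triangle $K$ is an identity of the form $$\frac1{|K|}\iint_Kp\,dx\,dy=\sum_{i=1}^3\frac{w_i}{l_K^{(i)}}\int_{e_K^{(i)}}p\,ds+\sum_{s=1}^S\omega_s\,p(\xi_s,\eta_s).$$ It is *feasible* for $\mathbb P^k$ (polynomials in $(x,y)$ of total degree at most $k$) if (i) it holds exactly for all $p\in\mathbb P^k$; (ii) the edge weights $w_1,w_2,w_3$ and internal node weights $\omega_1,\dots,\omega_S$ are all positive and sum to one; (iii) all internal nodes $(\xi_s,\eta_s)$ lie in $K$. The number $S\ge0$ of internal nodes is arbitrary. The BP CFL number of a feasible convex decomposition is $\mathcal C_{\rm BP}=\min\{w_1/l_K^{(1)},w_2/l_K^{(2)},w_3/l_K^{(3)}\}$. A feasible convex decomposition for $\mathbb P^k$ on $K$ is *optimal* if no other feasible convex decomposition for $\mathbb P^k$ on $K$ has a strictly larger $\mathcal C_{\rm BP}$. *)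

theory Defs
  imports "HOL-Analysis.Analysis"
begin

text \<open>
  A triangle is given by its vertices, indexed by the numeral type \<open>3\<close>. Index arithmetic in this
  type is cyclic (\<open>3 = 0\<close>, \<open>3 + 1 = 1\<close>), so the edge opposite \<open>v i\<close> joins \<open>v (i + 1)\<close> and
  \<open>v (i + 2)\<close>.
\<close>

definition is_triangle :: "(3 \<Rightarrow> real^2) \<Rightarrow> bool" where
  "is_triangle v \<longleftrightarrow> \<not> collinear (range v)"

definition cell :: "(3 \<Rightarrow> real^2) \<Rightarrow> (real^2) set" where
  "cell v = convex hull (range v)"

definition edge :: "(3 \<Rightarrow> real^2) \<Rightarrow> 3 \<Rightarrow> real \<Rightarrow> real^2" where
  "edge v i = linepath (v (i + 1)) (v (i + 2))"

definition edge_length :: "(3 \<Rightarrow> real^2) \<Rightarrow> 3 \<Rightarrow> real" where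
  "edge_length v i = dist (v (i + 1)) (v (i + 2))"

text \<open>The integral of \<open>f\<close> along the path \<open>g\<close> with respect to arc length.\<close>

definition arc_integral :: "(real \<Rightarrow> real^2) \<Rightarrow> (real^2 \<Rightarrow> real) \<Rightarrow> real" where
  "arc_integral g f =
     integral {0..1} (\<lambda>t. f (g t) * norm (vector_derivative g (at t within {0..1})))"

definition cell_average :: "(3 \<Rightarrow> real^2) \<Rightarrow> (real^2 \<Rightarrow> real) \<Rightarrow> real" where
  "cell_average v p = integral (cell v) p / measure lebesgue (cell v)"

text \<open>The polynomial functions in \<open>(x, y)\<close> of total degree at most \<open>k\<close>.\<close>

definition poly_space :: "nat \<Rightarrow> (real^2 \<Rightarrow> real) set" where
  "poly_space k = {p. \<exists>c :: nat \<Rightarrow> nat \<Rightarrow> real.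
     \<forall>z. p z = (\<Sum>(i, j) \<in> {(i, j). i + j \<le> k}. c i j * (z $ 1) ^ i * (z $ 2) ^ j)}"

text \<open>
  Internal nodes are indexed by \<open>{1..num_nodes}\<close>; the values of \<open>node_weight\<close> and \<open>node\<close> at other
  indices are irrelevant.
\<close>

record decomposition =
  edge_weight :: "3 \<Rightarrow> real"
  num_nodes :: nat
  node_weight :: "nat \<Rightarrow> real"
  node :: "nat \<Rightarrow> real^2"

definition decomposition_value ::
    "(3 \<Rightarrow> real^2) \<Rightarrow> decomposition \<Rightarrow> (real^2 \<Rightarrow> real) \<Rightarrow> real" where
  "decomposition_value v D p =
     (\<Sum>i\<in>UNIV. edge_weight D i / edge_length v i * arc_integral (edge v i) p) +
     (\<Sum>s = 1..num_nodes D. node_weight D s * p (node D s))"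

definition feasible :: "nat \<Rightarrow> (3 \<Rightarrow> real^2) \<Rightarrow> decomposition \<Rightarrow> bool" where
  "feasible k v D \<longleftrightarrow>
     (\<forall>p \<in> poly_space k. cell_average v p = decomposition_value v D p) \<and>
     (\<forall>i. edge_weight D i > 0) \<and>
     (\<forall>s \<in> {1..num_nodes D}. node_weight D s > 0) \<and>
     (\<Sum>i\<in>UNIV. edge_weight D i) + (\<Sum>s = 1..num_nodes D. node_weight D s) = 1 \<and>
     (\<forall>s \<in> {1..num_nodes D}. node D s \<in> cell v)"

definition BP_CFL :: "(3 \<Rightarrow> real^2) \<Rightarrow> decomposition \<Rightarrow> real" where
  "BP_CFL v D = Min (range (\<lambda>i. edge_weight D i / edge_length v i))"

definition optimal :: "nat \<Rightarrow> (3 \<Rightarrow> real^2) \<Rightarrow> decomposition \<Rightarrow> bool" where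
  "optimal k v D \<longleftrightarrow>
     feasible k v D \<and> \<not> (\<exists>D'. feasible k v D' \<and> BP_CFL v D' > BP_CFL v D)"

text \<open>
  For an equilateral triangle there is no internal node; the divisions by
  \<open>l 1 + l 2 - 2 * l 3 = 0\<close> then only affect the irrelevant field \<open>node\<close>.
\<close>

definition P1_decomposition :: "(3 \<Rightarrow> real^2) \<Rightarrow> decomposition" where
  "P1_decomposition v = (let l = edge_length v in
     \<lparr> edge_weight = (\<lambda>i. 2 * l i / (3 * l 1 + 3 * l 2)),
       num_nodes = (if l 1 = l 2 \<and> l 2 = l 3 then 0 else 1),
       node_weight = (\<lambda>_. (l 1 + l 2 - 2 * l 3) / (3 * l 1 + 3 * l 2)),
       node = (\<lambda>_. ((l 1 - l 3) *\<^sub>R v 1 + (l 2 - l 3) *\<^sub>R v 2) /\<^sub>R (l 1 + l 2 - 2 * l 3)) \<rparr>)"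

end

theory Submission
  imports Defs
begin

text \<open>
  Functions in \<open>poly_space 1\<close> are affine, and an affine function is determined by its values at the
  three vertices. Both sides of the decomposition identity can be expressed through these values:
  the cell average is their mean, and the average over an edge is the mean of the values at its two
  endpoints. Write \<open>l\<close> for \<open>edge_length v\<close>. Exactness of the proposed decomposition then says that
  each vertex receives total weight \<open>1 / 3\<close>. Vertex \<open>3\<close> receives \<open>(w 1 + w 2) / 2 = 1 / 3\<close> from the
  two edges that meet there; the vertices \<open>1\<close> and \<open>2\<close> lie on the shortest edge \<open>3\<close> and receive
  at most \<open>1 / 3\<close> from the edges. An internal node on that edge makes up any difference.

  For optimality, test an arbitrary feasible decomposition with the barycentric coordinate of vertex
  \<open>3\<close>, where the two longest edges meet. Its cell average is \<open>1 / 3\<close>, its averages over edges \<open>1\<close>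
  and \<open>2\<close> are \<open>1 / 2\<close>, and it is nonnegative on the cell, so the internal nodes can only contribute
  nonnegatively. Hence \<open>(w 1 + w 2) / 2 \<le> 1 / 3\<close>. As \<open>w i \<ge> BP_CFL * l i\<close>, this bounds
  the CFL number by \<open>2 / (3 * l 1 + 3 * l 2)\<close>, which the proposed decomposition attains.

  The cell average is computed from symmetry instead of by iterated integration: the affine map that
  permutes the vertices cyclically preserves the cell and its area, and the sum of a point and its
  two images under this map is the constant sum of the vertices.
\<close>

section \<open>Affine functions on a triangle\<close>

lemma range_3: "range v = {v 1, v 2, v (3::3)}"
  by (auto simp: UNIV_3)

text \<open>
  The simplifier merges \<open>2 + 2\<close> and \<open>3 + 2\<close> to numerals that have to be reduced modulo \<open>3\<close>.
\<close>

lemma index_4: "(4::3) = 1"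
  by simp

lemma index_5: "(5::3) = 2"
  by simp

text \<open>
  The two edge vectors that leave \<open>v 1\<close> are linearly independent, so a linear map can take any values
  on them. This one lemma provides both the cyclic symmetry of the triangle (with values in the
  plane) and the barycentric coordinates (with real values).
\<close>

lemma affine_interpolation:
  fixes v :: "3 \<Rightarrow> real^2" and y :: "3 \<Rightarrow> 'b::real_vector"
  assumes "is_triangle v"
  shows "\<exists>A b. linear A \<and> (\<forall>i. b + A (v i) = y i)"
proof -
  let ?e2 = "v 2 - v 1" and ?e3 = "v 3 - v 1"
  have nc: "\<not> collinear {v 1, v 2, v 3}"
    using assms by (simp add: is_triangle_def range_3)
  hence dist: "v 1 \<noteq> v 2" "v 1 \<noteq> v 3" "v 2 \<noteq> v 3"
    and "\<not> affine_dependent {v 1, v 2, v 3}"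
    unfolding collinear_3_eq_affine_dependent by auto
  hence "independent ((+) (- v 1) ` {v 2, v 3})"
    using affine_dependent_iff_dependent[of "v 1" "{v 2, v 3}"] by simp
  hence ind: "independent {?e2, ?e3}"
    by simp
  obtain A where "linear A" and
    A: "\<forall>x\<in>{?e2, ?e3}. A x = (if x = ?e2 then y 2 - y 1 else y 3 - y 1)"
    using linear_independent_extend[OF ind, of "\<lambda>x. if x = ?e2 then y 2 - y 1 else y 3 - y 1"]
    by blast
  have "A (v 2) = A (v 1) + (y 2 - y 1)" "A (v 3) = A (v 1) + (y 3 - y 1)"
    using A dist by (simp_all add: linear_diff[OF \<open>linear A\<close>] algebra_simps)
  hence "(y 1 - A (v 1)) + A (v i) = y i" for i
    using exhaust_3[of i] by auto
  with \<open>linear A\<close> show ?thesis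
    by blast
qed

lemma poly_space_1_iff:
  "p \<in> poly_space 1 \<longleftrightarrow> (\<exists>f b. linear f \<and> p = (\<lambda>z. b + f z))"
proof
  have idx: "{(i, j). i + j \<le> (1::nat)} = {(0, 0), (1, 0), (0, 1)}"
    by auto
  {
    assume "p \<in> poly_space 1"
    then obtain c :: "nat \<Rightarrow> nat \<Rightarrow> real" where
      "\<And>z. p z = (\<Sum>(i, j) \<in> {(i, j). i + j \<le> 1}. c i j * (z $ 1) ^ i * (z $ 2) ^ j)"
      unfolding poly_space_def by blast
    hence "p = (\<lambda>z. c 0 0 + (c 1 0 * z $ 1 + c 0 1 * z $ 2))"
      unfolding idx by auto
    moreover have "linear (\<lambda>z::real^2. c 1 0 * z $ 1 + c 0 1 * z $ 2)"
      by (rule linearI) (auto simp: algebra_simps)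
    ultimately show "\<exists>f b. linear f \<and> p = (\<lambda>z. b + f z)"
      by blast
  next
    assume "\<exists>f b. linear f \<and> p = (\<lambda>z. b + f z)"
    then obtain f b where f: "linear f" and p: "p = (\<lambda>z. b + f z)"
      by blast
    define c where "c i j = (if i = 1 then f (axis 1 1) else if j = 1 then f (axis 2 1) else b)"
      for i j :: nat
    have fz: "f z = z $ 1 * f (axis 1 1) + z $ 2 * f (axis 2 1)" for z
    proof -
      have "z = z $ 1 *\<^sub>R axis 1 1 + z $ 2 *\<^sub>R axis 2 1"
        by (simp add: vec_eq_iff forall_2 axis_def)
      hence "f z = f (z $ 1 *\<^sub>R axis 1 1 + z $ 2 *\<^sub>R axis 2 1)"
        by simp
      thus ?thesis
        by (simp add: linear_add[OF f] linear_scale[OF f])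
    qed
    have "p z = (\<Sum>(i, j) \<in> {(i, j). i + j \<le> 1}. c i j * (z $ 1) ^ i * (z $ 2) ^ j)" for z
      unfolding p idx fz[of z] by (simp add: c_def)
    thus "p \<in> poly_space 1"
      unfolding poly_space_def by blast
  }
qed

section \<open>The cell average\<close>

lemma absolutely_integrable_continuous_compact:
  fixes f :: "'a::euclidean_space \<Rightarrow> 'b::euclidean_space"
  assumes "compact S" "continuous_on S f"
  shows "f absolutely_integrable_on S"
  using borel_integrable_compact[OF assms]
  by (auto simp: set_integrable_def
      intro!: integrable_completion[THEN iffD2] borel_measurable_integrable)

lemma compact_cell: "compact (cell v)"
  unfolding cell_def by (intro finite_imp_compact_convex_hull finite_imageI) simp

lemma has_integral_const_cell:
  "((\<lambda>x. c) has_integral measure lebesgue (cell v) *\<^sub>R c) (cell v)"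
proof (rule has_integral_scaleR_left[of "\<lambda>_. 1", simplified scaleR_one])
  have meas: "cell v \<in> lmeasurable"
    by (rule lmeasurable_compact[OF compact_cell])
  show "((\<lambda>_. 1) has_integral measure lebesgue (cell v)) (cell v)"
    unfolding has_integral_iff lmeasure_integral[OF meas]
    using meas by (simp only: lmeasurable_iff_integrable_on simp_thms)
qed

lemma measure_cell_pos:
  assumes "is_triangle v"
  shows "measure lebesgue (cell v) > 0"
proof -
  have nc: "\<not> collinear {v 1, v 2, v 3}"
    using assms by (simp add: is_triangle_def range_3)
  have "(1/3) *\<^sub>R v 1 + (1/3) *\<^sub>R v 2 + (1/3) *\<^sub>R v 3 \<in> interior (cell v)"
    unfolding cell_def range_3 interior_convex_hull_3_minimal[OF nc, simplified]
    by (auto intro!: exI[of _ "1/3::real"])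
  hence "\<not> negligible (cell v)"
    using negligible_subset interior_subset open_not_negligible open_interior by blast
  thus ?thesis
    using negligible_iff_measure0[OF lmeasurable_compact[OF compact_cell]]
    by (simp add: zero_less_measure_iff)
qed

lemma affine_constant_on_cell:
  assumes f: "linear f" and vert: "\<And>i. b + f (v i) = c" and "z \<in> cell v"
  shows "b + f z = c"
proof -
  have "range v \<subseteq> f -` {c - b}"
    using vert by (auto simp: algebra_simps)
  hence "cell v \<subseteq> f -` {c - b}"
    unfolding cell_def by (intro hull_minimal convex_linear_vimage[OF f] convex_singleton)
  thus ?thesis
    using \<open>z \<in> cell v\<close> by auto
qed

text \<open>
  The centroid formula. Let \<open>T\<close> be the affine map with \<open>T (v i) = v (i + 1)\<close>. It maps the cell onto
  itself, and as the cell has positive finite area, the determinant of its linear part is \<open>1\<close> up to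
  sign. So \<open>x\<close>, \<open>T x\<close> and \<open>T (T x)\<close> have the same integral, while the affine function
  \<open>x + T x + T (T x)\<close> takes the value \<open>v 1 + v 2 + v 3\<close> at each vertex and hence on the whole cell.
\<close>

lemma integral_cell_identity:
  fixes v :: "3 \<Rightarrow> real^2"
  assumes "is_triangle v"
  shows "integral (cell v) (\<lambda>x. x) = (measure lebesgue (cell v) / 3) *\<^sub>R (\<Sum>i\<in>UNIV. v i)"
proof -
  obtain A b where A: "linear A" and T: "\<And>i. b + A (v i) = v (i + 1)"
    using affine_interpolation[OF assms, of "\<lambda>i. v (i + 1)"] by blast
  define T where "T x = b + A x" for x
  have "T ` range v = range v"
    by (auto simp: T T_def range_3 index_4)
  have img: "T ` cell v = cell v"
  proof -
    have "T ` cell v = (+) b ` A ` cell v"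
      unfolding image_image T_def ..
    also have "\<dots> = convex hull ((+) b ` A ` range v)"
      unfolding cell_def convex_hull_translation convex_hull_linear_image[OF A] ..
    also have "(+) b ` A ` range v = T ` range v"
      unfolding image_image T_def ..
    finally show ?thesis
      unfolding \<open>T ` range v = range v\<close> cell_def .
  qed
  have der: "(T has_derivative A) (at x within S)" for x S
    unfolding T_def using A by (auto intro!: derivative_eq_intros linear_imp_has_derivative)
  have "measure lebesgue (T ` cell v) = measure lebesgue ((+) b ` A ` cell v)"
    unfolding image_image T_def ..
  also have "\<dots> = \<bar>det (matrix A)\<bar> * measure lebesgue (cell v)"
    by (simp only: measure_translation measure_linear_image[OF A lmeasurable_compact[OF compact_cell]])
  finally have det: "\<bar>det (matrix A)\<bar> = 1"
    using measure_cell_pos[OF assms] unfolding img by simp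
  hence "inj A"
    using det_nz_iff_inj[OF A] by auto
  hence inj: "inj_on T (cell v)"
    unfolding T_def by (auto simp: inj_on_def)
  have cont: "continuous_on S T" for S
    using der by (meson has_derivative_continuous_on)
  have inv: "integral (cell v) (\<lambda>x. f (T x)) = integral (cell v) f" if "continuous_on (cell v) f"
    for f :: "real^2 \<Rightarrow> real^2"
    using integral_change_of_variables[OF _ der inj, of f] det img
      absolutely_integrable_continuous_compact[OF compact_cell that] lmeasurable_compact[OF compact_cell, of v]
    by auto
  have orbit: "x + T x + T (T x) = (\<Sum>i\<in>UNIV. v i)" if "x \<in> cell v" for x
  proof -
    have lin: "linear (\<lambda>x. x + A x + A (A x))"
      by (intro linear_compose_add linear_ident A linear_compose[OF A A, unfolded o_def])
    have eq: "x + T x + T (T x) = (b + (b + A b)) + (x + A x + A (A x))" for x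
      by (simp add: T_def linear_add[OF A] algebra_simps)
    have "v i + T (v i) + T (T (v i)) = (\<Sum>i\<in>UNIV. v i)" for i
      using exhaust_3[of i] by (auto simp: T T_def sum_3 index_4 index_5 algebra_simps)
    thus ?thesis
      unfolding eq by (rule affine_constant_on_cell[OF lin _ that])
  qed
  have int: "f integrable_on cell v" if "continuous_on (cell v) f" for f :: "real^2 \<Rightarrow> real^2"
    using absolutely_integrable_continuous_compact[OF compact_cell that]
    by (rule set_lebesgue_integral_eq_integral(1))
  have cont2: "continuous_on (cell v) (\<lambda>x. T (T x))"
    using continuous_on_compose2[OF cont[of UNIV] cont] by blast
  let ?I = "integral (cell v) (\<lambda>x. x)"
  have "3 *\<^sub>R ?I = ?I + integral (cell v) T + integral (cell v) (\<lambda>x. T (T x))"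
    using inv[of "\<lambda>x. x"] inv[OF cont] by (simp add: vec_eq_iff)
  also have "\<dots> = integral (cell v) (\<lambda>x. x + T x + T (T x))"
    using int cont cont2 by (simp add: integral_add integrable_add)
  also have "\<dots> = integral (cell v) (\<lambda>x. \<Sum>i\<in>UNIV. v i)"
    using orbit by (intro integral_cong)
  also have "\<dots> = measure lebesgue (cell v) *\<^sub>R (\<Sum>i\<in>UNIV. v i)"
    by (intro integral_unique has_integral_const_cell)
  finally show ?thesis
    by (simp add: vec_eq_iff field_simps)
qed

lemma cell_average_affine:
  fixes v :: "3 \<Rightarrow> real^2"
  assumes "is_triangle v" and f: "linear f"
  shows "cell_average v (\<lambda>z. b + f z) = (\<Sum>i\<in>UNIV. b + f (v i)) / 3"
proof -
  have int: "g integrable_on cell v" if "continuous_on (cell v) g"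
    for g :: "real^2 \<Rightarrow> 'a::euclidean_space"
    using absolutely_integrable_continuous_compact[OF compact_cell that]
    by (rule set_lebesgue_integral_eq_integral(1))
  have blin: "bounded_linear f"
    using f by (simp add: linear_linear)
  have id: "(\<lambda>x. x) integrable_on cell v"
    by (intro int continuous_intros)
  have "integral (cell v) (\<lambda>z. b + f z) = integral (cell v) (\<lambda>z. b) + integral (cell v) f"
    using int[OF continuous_on_const] int[OF linear_continuous_on[OF blin]]
    by (rule integral_add)
  also have "integral (cell v) f = f (integral (cell v) (\<lambda>x. x))"
    using integral_linear[OF id blin] by (simp add: o_def)
  also have "integral (cell v) (\<lambda>z. b) = measure lebesgue (cell v) * b"
    using has_integral_const_cell[of b v] by (simp add: integral_unique)
  finally show ?thesis
    using measure_cell_pos[OF assms(1)]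
    by (simp add: cell_average_def integral_cell_identity[OF assms(1)] linear_scale[OF f] linear_add[OF f] sum_3 field_simps)
qed

section \<open>The value of a decomposition\<close>

text \<open>The trapezoidal rule, which is exact for affine functions.\<close>

lemma arc_integral_affine:
  assumes f: "linear f"
  shows "arc_integral (edge v i) (\<lambda>z. b + f z) =
    edge_length v i * ((b + f (v (i + 1))) + (b + f (v (i + 2)))) / 2"
proof -
  define x y where "x = v (i + 1)" and "y = v (i + 2)"
  \<comment> \<open>An antiderivative: at parameter \<open>t\<close> the integrand is
    \<open>dist x y * ((b + f x) + t * (f y - f x))\<close>.\<close>
  define F where "F t = dist x y * (t * (b + f x) + t\<^sup>2 / 2 * (f y - f x))" for t :: real
  have "((\<lambda>t. (b + f (linepath x y t)) * dist x y) has_integral F 1 - F 0) {0..1}"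
  proof (rule fundamental_theorem_of_calculus)
    fix t :: real
    have "f (linepath x y t) = (1 - t) * f x + t * f y"
      by (simp add: linepath_def linear_add[OF f] linear_scale[OF f])
    hence *: "(b + f (linepath x y t)) * dist x y = dist x y * (b + f x + t * (f y - f x))"
      by (simp only:) (simp add: algebra_simps)
    show "(F has_vector_derivative (b + f (linepath x y t)) * dist x y) (at t within {0..1})"
      unfolding F_def has_real_derivative_iff_has_vector_derivative[symmetric] *
      by (auto intro!: derivative_eq_intros)
  qed simp
  moreover have "arc_integral (edge v i) (\<lambda>z. b + f z) =
      integral {0..1} (\<lambda>t. (b + f (linepath x y t)) * dist x y)"
    unfolding arc_integral_def edge_def x_def y_def
    by (intro integral_cong) (simp add: vector_derivative_linepath_within dist_norm norm_minus_commute)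
  ultimately show ?thesis
    by (simp add: integral_unique F_def edge_length_def x_def y_def field_simps)
qed

lemma edge_length_pos:
  assumes "is_triangle v"
  shows "edge_length v i > 0"
  using assms exhaust_3[of i]
  by (auto simp: is_triangle_def range_3 edge_length_def collinear_3_eq_affine_dependent index_4 index_5)

lemma decomposition_value_affine:
  assumes "is_triangle v" "linear f"
  shows "decomposition_value v D (\<lambda>z. b + f z) =
    (\<Sum>i\<in>UNIV. edge_weight D i * ((b + f (v (i + 1))) + (b + f (v (i + 2)))) / 2) +
    (\<Sum>s = 1..num_nodes D. node_weight D s * (b + f (node D s)))"
  unfolding decomposition_value_def arc_integral_affine[OF assms(2)]
  using edge_length_pos[OF assms(1)] by (simp add: less_imp_neq[symmetric])

section \<open>The upper bound for the CFL number\<close>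

lemma BP_CFL_le:
  assumes "is_triangle v"
  shows "BP_CFL v D * edge_length v i \<le> edge_weight D i"
proof -
  have "BP_CFL v D \<le> edge_weight D i / edge_length v i"
    unfolding BP_CFL_def by (intro Min_le) auto
  thus ?thesis
    using edge_length_pos[OF assms, of i] by (simp add: field_simps)
qed

text \<open>
  The test function is the barycentric coordinate of vertex \<open>3\<close>: the nodes contribute nonnegatively
  to its average, and edge \<open>3\<close>, on which it vanishes, contributes nothing, so that only the weights
  of the edges \<open>1\<close> and \<open>2\<close> remain. Testing with another vertex bounds the CFL number in the same way
  by the two edges meeting there; the longest two edges give the smallest bound.
\<close>

lemma feasible_BP_CFL_le:
  assumes tri: "is_triangle v" and feas: "feasible 1 v D"
  shows "BP_CFL v D \<le> 2 / (3 * edge_length v 1 + 3 * edge_length v 2)"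
proof -
  obtain f b where f: "linear f" and bary: "\<And>i. b + f (v i) = (if i = 3 then 1 else 0 :: real)"
    using affine_interpolation[OF tri, of "\<lambda>i. if i = 3 then 1 else 0 :: real"] by blast
  have "range v \<subseteq> f -` {- b..}"
    using bary by (auto split: if_splits) (smt (verit))
  hence "cell v \<subseteq> f -` {- b..}"
    unfolding cell_def by (intro hull_minimal convex_linear_vimage[OF f] convex_real_interval)
  hence "b + f z \<ge> 0" if "z \<in> cell v" for z
    using that by fastforce
  hence nodes: "(\<Sum>s = 1..num_nodes D. node_weight D s * (b + f (node D s))) \<ge> 0"
    using feas by (intro sum_nonneg mult_nonneg_nonneg) (auto simp: feasible_def less_imp_le)
  have "1 / 3 = cell_average v (\<lambda>z. b + f z)"
    unfolding cell_average_affine[OF tri f] by (simp add: bary)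
  also have "\<dots> = decomposition_value v D (\<lambda>z. b + f z)"
  proof -
    have "(\<lambda>z. b + f z) \<in> poly_space 1"
      using f poly_space_1_iff by blast
    thus ?thesis
      using feas by (simp add: feasible_def)
  qed
  also have "\<dots> \<ge> (edge_weight D 1 + edge_weight D 2) / 2"
    using nodes unfolding decomposition_value_affine[OF tri f] by (simp add: bary sum_3)
  finally have "BP_CFL v D * (edge_length v 1 + edge_length v 2) \<le> 2 / 3"
    using BP_CFL_le[OF tri, of D 1] BP_CFL_le[OF tri, of D 2] by (simp add: algebra_simps)
  thus ?thesis
    using edge_length_pos[OF tri, of 1] edge_length_pos[OF tri, of 2] by (simp add: field_simps)
qed

section \<open>The proposed decomposition\<close>

text \<open>The weights are proportional to the lengths, so all three ratios in the minimum agree.\<close>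

lemma P1_BP_CFL:
  assumes "is_triangle v"
  shows "BP_CFL v (P1_decomposition v) = 2 / (3 * edge_length v 1 + 3 * edge_length v 2)"
proof -
  have "edge_length v i \<noteq> 0" for i
    using edge_length_pos[OF assms, of i] by simp
  thus ?thesis
    unfolding BP_CFL_def by (simp add: P1_decomposition_def Let_def)
qed

text \<open>
  The edges give vertex \<open>1\<close> the weight \<open>(l 2 + l 3) / (3 * l 1 + 3 * l 2)\<close>, which is \<open>1 / 3\<close>
  minus \<open>(l 1 - l 3) / (3 * l 1 + 3 * l 2)\<close>, and symmetrically for vertex \<open>2\<close>. These two
  deficits are nonnegative because edge \<open>3\<close> is the shortest, and the internal node is their weighted
  mean of \<open>v 1\<close> and \<open>v 2\<close>, carrying their sum as its weight. Both vanish in the equilateral case.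
\<close>

lemma P1_feasible:
  fixes v :: "3 \<Rightarrow> real^2"
  assumes tri: "is_triangle v"
    and l12: "edge_length v 1 \<ge> edge_length v 2"
    and l23: "edge_length v 2 \<ge> edge_length v 3"
  shows "feasible 1 v (P1_decomposition v)"
proof -
  define l where "l = edge_length v"
  have pos: "l i > 0" for i
    unfolding l_def by (rule edge_length_pos[OF tri])
  have le: "l 3 \<le> l 2" "l 2 \<le> l 1" and den: "3 * l 1 + 3 * l 2 > 0"
    using l12 l23 pos[of 1] pos[of 2] by (auto simp: l_def)
  let ?D = "P1_decomposition v"
  let ?m = "l 1 + l 2 - 2 * l 3"
  have w: "edge_weight ?D i = 2 * l i / (3 * l 1 + 3 * l 2)" for i
    by (simp add: P1_decomposition_def l_def Let_def)
  have \<omega>: "node_weight ?D s = ?m / (3 * l 1 + 3 * l 2)" for s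
    by (simp add: P1_decomposition_def l_def Let_def)
  have node: "node ?D s = ((l 1 - l 3) *\<^sub>R v 1 + (l 2 - l 3) *\<^sub>R v 2) /\<^sub>R ?m" for s
    by (simp add: P1_decomposition_def l_def Let_def)
  \<comment> \<open>As \<open>?m = (l 1 - l 3) + (l 2 - l 3)\<close>, it is zero only for an equilateral triangle.\<close>
  have n: "(num_nodes ?D = 0 \<and> ?m = 0 \<and> l 1 = l 3 \<and> l 2 = l 3) \<or> (num_nodes ?D = 1 \<and> ?m > 0)"
    using le by (auto simp: P1_decomposition_def l_def Let_def)
  have node_in: "node ?D s \<in> cell v" if "?m > 0" for s
  proof -
    have "node ?D s = ((l 1 - l 3) / ?m) *\<^sub>R v 1 + ((l 2 - l 3) / ?m) *\<^sub>R v 2"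
      by (simp add: node scaleR_add_right divide_inverse mult.commute)
    also have "\<dots> \<in> cell v"
      using that le unfolding cell_def
      by (intro convexD[OF convex_convex_hull] hull_inc) (auto simp: add_divide_distrib[symmetric])
    finally show ?thesis .
  qed
  have exact: "cell_average v p = decomposition_value v ?D p" if p1: "p \<in> poly_space 1" for p
  proof -
    obtain f b where f: "linear f" and p: "p = (\<lambda>z. b + f z)"
      using p1 unfolding poly_space_1_iff by blast
    have nodes: "(\<Sum>s = 1..num_nodes ?D. node_weight ?D s * (b + f (node ?D s))) =
        ((l 1 - l 3) * p (v 1) + (l 2 - l 3) * p (v 2)) / (3 * l 1 + 3 * l 2)"
      using n
    proof
      assume "num_nodes ?D = 1 \<and> ?m > 0"
      moreover have "?m * (b + f (node ?D s)) = (l 1 - l 3) * p (v 1) + (l 2 - l 3) * p (v 2)"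
        if "?m > 0" for s
      proof -
        have "?m * (b + f (node ?D s)) = ?m * b + ((l 1 - l 3) * f (v 1) + (l 2 - l 3) * f (v 2))"
          using that by (simp add: node linear_add[OF f] linear_scale[OF f] distrib_left
              mult.assoc[symmetric])
        thus ?thesis
          by (simp add: p algebra_simps)
      qed
      ultimately show ?thesis
        by (simp add: \<omega>)
    qed simp
    have halve: "2 * a / d * x / 2 = a * x / d" for a d x :: real
      by simp
    let ?d = "3 * l 1 + 3 * l 2"
    have "decomposition_value v ?D p =
        (\<Sum>i\<in>UNIV. l i * (p (v (i + 1)) + p (v (i + 2))) / ?d) +
        ((l 1 - l 3) * p (v 1) + (l 2 - l 3) * p (v 2)) / ?d"
      by (simp only: p decomposition_value_affine[OF tri f] nodes[unfolded p] w halve)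
    also have "\<dots> = (l 1 + l 2) * (p (v 1) + p (v 2) + p (v 3)) / ?d"
      unfolding sum_3 add_divide_distrib[symmetric]
      by (simp add: index_4 index_5) (simp add: algebra_simps)
    also have "\<dots> = (p (v 1) + p (v 2) + p (v 3)) / 3"
      using den by (simp add: divide_eq_eq eq_divide_eq)
    also have "\<dots> = cell_average v p"
      unfolding p cell_average_affine[OF tri f] by (simp add: sum_3)
    finally show ?thesis
      by (rule sym)
  qed
  have "(\<Sum>s = 1..num_nodes ?D. node_weight ?D s) = ?m / (3 * l 1 + 3 * l 2)"
    using n by (auto simp: \<omega>)
  hence "(\<Sum>i\<in>UNIV. edge_weight ?D i) + (\<Sum>s = 1..num_nodes ?D. node_weight ?D s) =
      (2 * l 1 + 2 * l 2 + 2 * l 3 + ?m) / (3 * l 1 + 3 * l 2)"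
    by (simp only: sum_3 w add_divide_distrib)
  also have "\<dots> = 1"
    using den by simp
  finally have total:
    "(\<Sum>i\<in>UNIV. edge_weight ?D i) + (\<Sum>s = 1..num_nodes ?D. node_weight ?D s) = 1" .
  show ?thesis
    unfolding feasible_def
    using exact total n node_in den pos by (auto simp: w \<omega>)
qed

theorem theorem4p6:
  fixes v :: "3 \<Rightarrow> real^2"
  assumes "is_triangle v"
    and "edge_length v 1 \<ge> edge_length v 2"
    and "edge_length v 2 \<ge> edge_length v 3"
  shows "feasible 1 v (P1_decomposition v) \<and> optimal 1 v (P1_decomposition v)"
  using P1_feasible[OF assms] feasible_BP_CFL_le[OF assms(1)]
  unfolding optimal_def P1_BP_CFL[OF assms(1)] by (auto simp: not_less)

end
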